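(* Let $\lambda$ be a nonzero real number, let $m$ be a positive integer, $0<p\le 1$, and let $Y$ be the binomial random variable with parameter $(m,p)$, i.e. $P\{Y=i\}=\binom{m}{i}p^i(1-p)^{m-i}$ for $i=0,1,\dots,m$. Then, for all integers $n\ge k\ge 0$, $$S_{2}^{Y}(n,k)=\sum_{j=k}^{n}\sum_{i=j}^{n}m^{j}p^{i}S_{2}(j,k)S_{1}(i,j)S_{2}(n,i),$$ $$S_{1}^{Y}(n,k)=\sum_{j=k}^{n}\sum_{i=j}^{n}\frac{1}{p^{j}}\frac{1}{m^{i}}S_{1}(j,k)S_{2}(i,j)S_1(n,i),$$ $$S_{2,\lambda}^{Y}(n,k)=\sum_{j=k}^{n}\sum_{i=j}^{n}m^{j}p^{i}S_{2}(j,k)S_{1}(i,j)S_{2,\lambda}(n,i),$$ $$S_{1,\lambda}^{Y}(n,k)=\sum_{j=k}^{n}\sum_{i=j}^{n}\frac{1}{p^{j}}\frac{1}{m^{i}}S_{1,\lambda}(j,k)S_{2}(i,j)S_{1}(n,i).$$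
   Context: Classical notions. $S_2(n,k)$ and $S_1(n,k)$ are the Stirling numbers of the second kind and the (signed) Stirling numbers of the first kind: $\frac{1}{k!}(e^t-1)^k=\sum_{n\ge k}S_2(n,k)\frac{t^n}{n!}$, $\frac{1}{k!}(\log(1+t))^k=\sum_{n\ge k}S_1(n,k)\frac{t^n}{n!}$. For nonzero real $\lambda$: $(x)_{0,\lambda}=1$, $(x)_{n,\lambda}=x(x-\lambda)\cdots(x-(n-1)\lambda)$; $e_\lambda^x(t)=(1+\lambda t)^{x/\lambda}=\sum_{n\ge0}(x)_{n,\lambda}\frac{t^n}{n!}$, $e_\lambda(t)=e_\lambda^1(t)$; $\log_\lambda(t)=\frac1\lambda(t^\lambda-1)$. The degenerate Stirling numbers of the second and first kind are defined by $\frac{1}{k!}(e_\lambda(t)-1)^k=\sum_{n\ge k}S_{2,\lambda}(n,k)\frac{t^n}{n!}$ and $\frac{1}{k!}(\log_\lambda(1+t))^k=\sum_{n\ge k}S_{1,\lambda}(n,k)\frac{t^n}{n!}$. Probabilistic versions. For a random variable $Y$ whose moment generating function exists near $0$ and with $E[Y]\ne0$, put $e_Y(t)=E[e^{Yt}]-1=\sum_{n\ge1}E[Y^n]\frac{t^n}{n!}$ and $e_{Y,\lambda}(t)=E[e_\lambda^Y(t)]-1=\sum_{n\ge1}E[(Y)_{n,\lambda}]\frac{t^n}{n!}$ (power series in $t$), and let $\bar e_Y(t)$, $\bar e_{Y,\lambda}(t)$ be their compositional inverses. Then for $k\ge0$: $\frac{1}{k!}(e_Y(t))^k=\sum_{n\ge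 k}S_2^Y(n,k)\frac{t^n}{n!}$, $\frac{1}{k!}(\bar e_Y(t))^k=\sum_{n\ge k}S_1^Y(n,k)\frac{t^n}{n!}$, $\frac{1}{k!}(e_{Y,\lambda}(t))^k=\sum_{n\ge k}S_{2,\lambda}^Y(n,k)\frac{t^n}{n!}$, $\frac{1}{k!}(\bar e_{Y,\lambda}(t))^k=\sum_{n\ge k}S_{1,\lambda}^Y(n,k)\frac{t^n}{n!}$ define the probabilistic (degenerate) Stirling numbers associated with $Y$. *)

theory Defs
  imports
    "HOL-Probability.Probability"
    "HOL-Combinatorics.Stirling"
    "HOL-Computational_Algebra.Formal_Power_Series"
begin

definition stirling_of :: "real fps \<Rightarrow> nat \<Rightarrow> nat \<Rightarrow> real" where
  "stirling_of f n k = fact n * fps_nth (fps_const (1 / fact k) * f ^ k) n"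

text \<open>For a series \<open>f\<close> without constant term this is the usual defining identity
  \<open>f(t)\<^sup>k / k! = (\<Sum>n\<ge>k. stirling_of f n k * t\<^sup>n / n!)\<close>.\<close>

lemma fps_stirling_of:
  assumes "fps_nth f 0 = 0"
  shows "fps_const (1 / fact k) * f ^ k =
           Abs_fps (\<lambda>n. if k \<le> n then stirling_of f n k / fact n else 0)"
proof (rule fps_ext)
  fix n
  have "fps_nth (f ^ k) n = 0" if "n < k"
    using startsby_zero_power_prefix[OF assms] that by blast
  then show "fps_nth (fps_const (1 / fact k) * f ^ k) n =
      fps_nth (Abs_fps (\<lambda>n. if k \<le> n then stirling_of f n k / fact n else 0)) n"
    by (auto simp: stirling_of_def)
qed

definition S2 :: "nat \<Rightarrow> nat \<Rightarrow> real" where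
  "S2 = stirling_of (fps_exp 1 - 1)"

text \<open>The signed numbers; \<open>fps_ln 1\<close> is the series of \<open>log(1 + t)\<close>.\<close>

definition S1 :: "nat \<Rightarrow> nat \<Rightarrow> real" where
  "S1 = stirling_of (fps_ln 1)"

lemma stirling_of_Suc:
  "stirling_of f (Suc n) (Suc k) =
     fact n * fps_nth (fps_const (1 / fact k) * f ^ k * fps_deriv f) n"
proof -
  have "fps_nth (fps_deriv (f ^ Suc k)) n = real (Suc n) * fps_nth (f ^ Suc k) (Suc n)"
    by (simp only: fps_deriv_nth Suc_eq_plus1)
  moreover have "fps_deriv (f ^ Suc k) = fps_const (real (Suc k)) * (f ^ k * fps_deriv f)"
    by (subst fps_deriv_power) (simp add: mult_ac)
  ultimately have *: "real (Suc n) * fps_nth (f ^ Suc k) (Suc n) =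
      real (Suc k) * fps_nth (f ^ k * fps_deriv f) n"
    by (simp only: fps_mult_left_const_nth)
  have "stirling_of f (Suc n) (Suc k) =
      fact n / fact (Suc k) * (real (Suc n) * fps_nth (f ^ Suc k) (Suc n))"
    by (simp add: stirling_of_def del: power_Suc)
  also have "\<dots> = fact n / fact k * fps_nth (f ^ k * fps_deriv f) n"
    unfolding * by (simp del: of_nat_Suc)
  finally show ?thesis
    by (simp add: mult.assoc)
qed

lemma stirling_of_0_left: "fps_nth f 0 = 0 \<Longrightarrow> stirling_of f 0 k = (if k = 0 then 1 else 0)"
  by (auto simp: stirling_of_def fps_nth_power_0)

lemma stirling_of_0_right: "stirling_of f n 0 = (if n = 0 then 1 else 0)"
  by (auto simp: stirling_of_def)

lemma S2_eq_Stirling: "S2 n k = real (Stirling n k)"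
proof (induction n k rule: Stirling.induct)
  case (4 n k)
  have "fps_deriv (fps_exp 1 - 1 :: real fps) = (fps_exp 1 - 1) + 1"
    by simp
  then have "S2 (Suc n) (Suc k) = fact n *
      fps_nth (fps_const (1 / fact k) * (fps_exp 1 - 1) ^ Suc k
             + fps_const (1 / fact k) * (fps_exp 1 - 1) ^ k) n"
    unfolding S2_def stirling_of_Suc by (simp add: algebra_simps)
  also have "\<dots> = real (Suc k) * S2 n (Suc k) + S2 n k"
    by (simp add: S2_def stirling_of_def field_simps del: power_Suc of_nat_Suc)
  finally show ?case using 4 by (simp add: algebra_simps)
qed (simp_all add: S2_def stirling_of_0_left stirling_of_0_right)

lemma S1_eq_stirling: "S1 n k = (-1) ^ (n + k) * real (stirling n k)"
proof (induction n k rule: stirling.induct)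
  case (4 n k)
  let ?l = "fps_ln 1 :: real fps"
  have d: "(1 + fps_X) * fps_deriv ?l = 1"
    unfolding fps_ln_deriv using inverse_mult_eq_1'[of "1 + fps_X :: real fps"] by simp
  define g where "g = fps_const (1 / fact k) * ?l ^ k * fps_deriv ?l"
  have g: "(1 + fps_X) * g = fps_const (1 / fact k) * ?l ^ k"
  proof -
    have "(1 + fps_X) * g = fps_const (1 / fact k) * ?l ^ k * ((1 + fps_X) * fps_deriv ?l)"
      unfolding g_def by (rule mult.left_commute)
    then show ?thesis by (simp only: d mult_1_right)
  qed
  have A: "S1 (Suc m) (Suc k) = fact m * fps_nth g m" for m
    unfolding S1_def stirling_of_Suc g_def ..
  have "S1 n k = fact n * fps_nth ((1 + fps_X) * g) n"
    by (simp add: S1_def stirling_of_def g)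
  also have "\<dots> = S1 (Suc n) (Suc k) + real n * S1 n (Suc k)"
  proof (cases n)
    case 0
    then show ?thesis by (simp add: A distrib_right)
  next
    case (Suc m)
    then show ?thesis by (simp add: A distrib_right) (simp add: algebra_simps)
  qed
  finally show ?case using 4 by (simp add: algebra_simps)
qed (simp_all add: S1_def stirling_of_0_left stirling_of_0_right)

definition deg_ffact :: "real \<Rightarrow> real \<Rightarrow> nat \<Rightarrow> real" where
  "deg_ffact l x n = (\<Prod>i<n. x - real i * l)"

definition deg_exp :: "real \<Rightarrow> real \<Rightarrow> real fps" where
  "deg_exp l x = Abs_fps (\<lambda>n. deg_ffact l x n / fact n)"

text \<open>That is, \<open>(1 + l t) powr (x / l)\<close>; \<open>fps_binomial a\<close> is the series of \<open>(1 + t) powr a\<close>.\<close>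

lemma deg_exp_eq_binomial:
  assumes "l \<noteq> 0"
  shows "deg_exp l x = fps_binomial (x / l) oo (fps_const l * fps_X)"
proof (rule fps_ext)
  fix n
  have "(\<Prod>i<n. x - real i * l) = (\<Prod>i<n. l * (x / l - real i))"
    using assms by (intro prod.cong) (auto simp: field_simps)
  also have "\<dots> = l ^ n * (\<Prod>i<n. x / l - real i)"
    by (simp add: prod.distrib)
  finally show "fps_nth (deg_exp l x) n = fps_nth (fps_binomial (x / l) oo (fps_const l * fps_X)) n"
    by (simp add: deg_exp_def deg_ffact_def fps_compose_linear gbinomial_prod_rev atLeast0LessThan)
qed

text \<open>The series of \<open>log\<^sub>l(1 + t) = ((1 + t) powr l - 1) / l\<close>.\<close>

definition deg_ln :: "real \<Rightarrow> real fps" where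
  "deg_ln l = fps_const (1 / l) * (fps_binomial l - 1)"

definition S2_deg :: "real \<Rightarrow> nat \<Rightarrow> nat \<Rightarrow> real" where
  "S2_deg l = stirling_of (deg_exp l 1 - 1)"

definition S1_deg :: "real \<Rightarrow> nat \<Rightarrow> nat \<Rightarrow> real" where
  "S1_deg l = stirling_of (deg_ln l)"

text \<open>The series \<open>E[e\<^sup>Y\<^sup>t] - 1\<close> and \<open>E[(1 + l t) powr (Y / l)] - 1\<close>
  in the formal variable \<open>t\<close>, with the expectation taken coefficientwise.\<close>

definition prob_exp :: "'a measure \<Rightarrow> ('a \<Rightarrow> real) \<Rightarrow> real fps" where
  "prob_exp M Y = Abs_fps (\<lambda>n. if n = 0 then 0 else (\<integral>\<omega>. Y \<omega> ^ n \<partial>M) / fact n)"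

definition prob_deg_exp :: "'a measure \<Rightarrow> ('a \<Rightarrow> real) \<Rightarrow> real \<Rightarrow> real fps" where
  "prob_deg_exp M Y l =
     Abs_fps (\<lambda>n. if n = 0 then 0 else (\<integral>\<omega>. deg_ffact l (Y \<omega>) n \<partial>M) / fact n)"

text \<open>Both series have linear coefficient \<open>E[Y]\<close>, so their compositional inverses
  \<open>fps_inv\<close> are meaningful exactly when \<open>E[Y] \<noteq> 0\<close>.\<close>

lemma prob_exp_compositional_inverse:
  assumes "(\<integral>\<omega>. Y \<omega> \<partial>M) \<noteq> 0"
  shows "fps_inv (prob_exp M Y) oo prob_exp M Y = fps_X"
    and "prob_exp M Y oo fps_inv (prob_exp M Y) = fps_X"
  using assms by (auto intro!: fps_inv fps_inv_right simp: prob_exp_def)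

lemma prob_deg_exp_compositional_inverse:
  assumes "(\<integral>\<omega>. Y \<omega> \<partial>M) \<noteq> 0"
  shows "fps_inv (prob_deg_exp M Y l) oo prob_deg_exp M Y l = fps_X"
    and "prob_deg_exp M Y l oo fps_inv (prob_deg_exp M Y l) = fps_X"
  using assms by (auto intro!: fps_inv fps_inv_right simp: prob_deg_exp_def deg_ffact_def)

definition S2_prob :: "'a measure \<Rightarrow> ('a \<Rightarrow> real) \<Rightarrow> nat \<Rightarrow> nat \<Rightarrow> real" where
  "S2_prob M Y = stirling_of (prob_exp M Y)"

definition S1_prob :: "'a measure \<Rightarrow> ('a \<Rightarrow> real) \<Rightarrow> nat \<Rightarrow> nat \<Rightarrow> real" where
  "S1_prob M Y = stirling_of (fps_inv (prob_exp M Y))"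

definition S2_prob_deg :: "'a measure \<Rightarrow> ('a \<Rightarrow> real) \<Rightarrow> real \<Rightarrow> nat \<Rightarrow> nat \<Rightarrow> real" where
  "S2_prob_deg M Y l = stirling_of (prob_deg_exp M Y l)"

definition S1_prob_deg :: "'a measure \<Rightarrow> ('a \<Rightarrow> real) \<Rightarrow> real \<Rightarrow> nat \<Rightarrow> nat \<Rightarrow> real" where
  "S1_prob_deg M Y l = stirling_of (fps_inv (prob_deg_exp M Y l))"

end

theory Submission
  imports Defs
begin

text \<open>
  Write \<open>E\<close> for the series of \<open>e\<^sup>t - 1\<close> and \<open>L\<close> for its compositional inverse \<open>log (1 + t)\<close>.
  Two observations carry the proof.

  First, the Stirling array of a composite \<open>f oo g\<close> is the matrix product of the arrays of \<open>f\<close> and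
  of \<open>g\<close> (\<open>stirling_of_compose\<close>), and multiplying a series by a constant \<open>c\<close> multiplies column
  \<open>k\<close> of its array by \<open>c ^ k\<close>. So every double sum in the theorem is the array of a series
  of the shape \<open>f oo a (g oo b h)\<close> (\<open>stirling_of_scaled_compose\<close>).

  Secondly, both generating series of a binomial variable have this shape. If \<open>e\<close> is \<open>e\<^sup>t\<close> or
  \<open>(1 + l t) powr (1 / l)\<close>, then the binomial theorem gives \<open>E[e\<^sup>Y] = (1 + p (e - 1)) ^ m\<close>, and
  \<open>(1 + t) powr c - 1\<close> is \<open>E oo c L\<close>; hence \<open>E[e\<^sup>Y] - 1 = E oo m (L oo p (e - 1))\<close>. This yields
  the two formulas of the second kind. Such a composite is inverted by inverting its factors and
  reversing their order (\<open>scaled_compose_left_inverse\<close>), which gives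
  \<open>h oo (1 / p) (E oo (1 / m) L)\<close> with \<open>h\<close> the inverse of \<open>e - 1\<close>, and so the two formulas
  of the first kind. The degenerate \<open>e - 1\<close> is itself \<open>E oo (1 / l) (L oo l t)\<close>, so the same
  inversion shows that \<open>deg_ln l\<close> is its inverse.
\<close>

section \<open>Stirling arrays of composites\<close>

lemma scale_compose: "(fps_const c * f) oo g = fps_const c * (f oo g :: real fps)"
  by (simp add: fps_const_mult_apply_left)

lemma compose_scale_assoc:
  fixes f g h :: "real fps"
  assumes "fps_nth g 0 = 0" "fps_nth h 0 = 0"
  shows "(f oo (fps_const c * g)) oo h = f oo (fps_const c * (g oo h))"
  using fps_compose_assoc[of h "fps_const c * g" f] assms by (simp add: scale_compose)

text \<open>
  Expand \<open>f ^ k oo g\<close> as \<open>\<Sum>j. fps_nth (f ^ k) j * g ^ j\<close>; the factor \<open>fact j\<close> in \<open>stirling_of f j k\<close>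
  cancels the \<open>1 / fact j\<close> in \<open>stirling_of g n j\<close>.
\<close>

lemma stirling_of_compose:
  assumes f: "fps_nth f 0 = 0" and g: "fps_nth g 0 = 0"
  shows "stirling_of (f oo g) n k = (\<Sum>j=k..n. stirling_of f j k * stirling_of g n j)"
proof -
  have "stirling_of (f oo g) n k = (\<Sum>j=0..n. stirling_of f j k * stirling_of g n j)"
    by (simp add: stirling_of_def fps_compose_power[OF g] fps_compose_nth sum_distrib_left
          sum_divide_distrib mult_ac)
  also have "\<dots> = (\<Sum>j=k..n. stirling_of f j k * stirling_of g n j)"
    using startsby_zero_power_prefix[OF f]
    by (intro sum.mono_neutral_right) (auto simp: stirling_of_def)
  finally show ?thesis .
qed

lemma stirling_of_scale: "stirling_of (fps_const c * f) n k = c ^ k * stirling_of f n k"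
  by (simp add: stirling_of_def power_mult_distrib fps_const_power)

lemma stirling_of_scaled_compose:
  fixes f g h :: "real fps"
  assumes "fps_nth f 0 = 0" "fps_nth g 0 = 0" "fps_nth h 0 = 0"
  shows "stirling_of (f oo (fps_const a * (g oo (fps_const b * h)))) n k =
    (\<Sum>j=k..n. \<Sum>i=j..n. a ^ j * b ^ i * stirling_of f j k * stirling_of g i j * stirling_of h n i)"
  using assms
  by (simp add: stirling_of_compose stirling_of_scale) (simp add: sum_distrib_left mult_ac)

section \<open>Compositional inverses\<close>

lemma fps_inv_eqI:
  fixes f g :: "real fps"
  assumes f: "fps_nth f 0 = 0" and gf: "g oo f = fps_X"
  shows "fps_inv f = g"
proof -
  have "fps_nth (g oo f) 1 = 1"
    using gf by simp
  then have f1: "fps_nth f 1 \<noteq> 0"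
    by (auto simp: fps_compose_nth)
  then have "g oo f = fps_inv f oo f"
    using f gf by (simp add: fps_inv)
  then show ?thesis
    using fps_compose_inj_right[OF f f1] by simp
qed

text \<open>
  The factors cancel in pairs from the middle: \<open>f'\<close> meets \<open>f\<close>, then \<open>g'\<close> meets \<open>g\<close>, and last
  \<open>h'\<close> meets \<open>h\<close>.
\<close>

lemma scaled_compose_left_inverse:
  fixes f g h f' g' h' :: "real fps"
  assumes 0: "fps_nth f 0 = 0" "fps_nth g 0 = 0" "fps_nth h 0 = 0"
      "fps_nth f' 0 = 0" "fps_nth g' 0 = 0"
    and inverses: "f' oo f = fps_X" "g' oo g = fps_X" "h' oo h = fps_X"
    and "a \<noteq> 0" "b \<noteq> 0"
  shows "(h' oo (fps_const (1 / b) * (g' oo (fps_const (1 / a) * f')))) oo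
    (f oo (fps_const a * (g oo (fps_const b * h)))) = fps_X"
proof -
  have f: "f' oo (f oo u) = u" if "fps_nth u 0 = 0" for u
    using fps_compose_assoc[of u f f'] that 0 inverses by simp
  have g: "g' oo (g oo u) = u" if "fps_nth u 0 = 0" for u
    using fps_compose_assoc[of u g g'] that 0 inverses by simp
  have unscale: "fps_const (1 / c) * (fps_const c * u) = u" if "c \<noteq> 0" for c :: real and u
    using that by (simp flip: mult.assoc)
  show ?thesis
    using assms by (simp add: compose_scale_assoc f g unscale)
qed

section \<open>Binomial series as composites\<close>

abbreviation expm1 :: "real fps" where
  "expm1 \<equiv> fps_exp 1 - 1"

abbreviation ln1p :: "real fps" where
  "ln1p \<equiv> fps_ln 1"

lemma ln1p_nth_0: "fps_nth ln1p 0 = 0"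
  by (simp add: fps_ln_nth)

lemma ln1p_compose_expm1: "ln1p oo expm1 = fps_X"
  by (simp add: fps_ln_fps_exp_inv fps_inv_fps_exp_compose)

lemma expm1_compose_ln1p: "expm1 oo ln1p = fps_X"
  by (simp add: fps_ln_fps_exp_inv fps_inv_fps_exp_compose)

text \<open>
  This is \<open>(1 + t) powr c = exp (c * log (1 + t))\<close>; both sides solve \<open>(1 + t) y' = c y\<close>, \<open>y(0) = 1\<close>.
\<close>

lemma fps_binomial_eq_compose: "fps_binomial c = 1 + (expm1 oo (fps_const c * ln1p))"
proof -
  have "fps_deriv (fps_exp c oo ln1p) = fps_const c * (fps_exp c oo ln1p) / (1 + fps_X)"
    using ln1p_nth_0
    by (simp add: fps_compose_deriv fps_ln_deriv scale_compose fps_divide_unit)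
  then have "fps_binomial c = fps_exp c oo ln1p"
    using fps_binomial_ODE_unique'[of "fps_exp c oo ln1p" c] by simp
  also have "\<dots> = (fps_exp 1 oo (fps_const c * fps_X)) oo ln1p"
    by simp
  also have "\<dots> = fps_exp 1 oo (fps_const c * ln1p)"
    using ln1p_nth_0 by (subst compose_scale_assoc) simp_all
  finally show ?thesis
    by (simp add: fps_compose_sub_distrib)
qed

lemma binomial_power_eq_scaled_compose:
  assumes "fps_nth h 0 = 0"
  shows "(1 + fps_const p * h) ^ m - 1 = expm1 oo (fps_const (real m) * (ln1p oo (fps_const p * h)))"
proof -
  have "(1 + fps_const p * h) ^ m = (1 + fps_X) ^ m oo (fps_const p * h)"
    using assms by (simp add: fps_compose_power[symmetric] fps_compose_add_distrib)
  also have "\<dots> = fps_binomial (real m) oo (fps_const p * h)"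
    by (simp add: fps_binomial_of_nat)
  also have "\<dots> = 1 + (expm1 oo (fps_const (real m) * (ln1p oo (fps_const p * h))))"
    using assms ln1p_nth_0
    by (simp add: fps_binomial_eq_compose fps_compose_add_distrib compose_scale_assoc)
  finally show ?thesis by simp
qed

lemma deg_exp_nth: "fps_nth (deg_exp l x) n = deg_ffact l x n / fact n"
  by (simp add: deg_exp_def)

lemma deg_exp_nth_0: "fps_nth (deg_exp l x) 0 = 1"
  by (simp add: deg_exp_nth deg_ffact_def)

lemma deg_exp_of_nat:
  assumes "l \<noteq> 0"
  shows "deg_exp l (real i) = deg_exp l 1 ^ i"
  using assms by (simp add: deg_exp_eq_binomial fps_compose_power fps_binomial_power)

lemma deg_ln_compose_deg_exp:
  assumes "l \<noteq> 0"
  shows "deg_ln l oo (deg_exp l 1 - 1) = fps_X"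
proof -
  have "deg_exp l 1 - 1 = expm1 oo (fps_const (1 / l) * (ln1p oo (fps_const l * fps_X)))"
    using assms ln1p_nth_0
    by (simp add: deg_exp_eq_binomial fps_binomial_eq_compose fps_compose_add_distrib
          compose_scale_assoc)
  moreover have "deg_ln l = fps_X oo (fps_const (1 / l) * (expm1 oo (fps_const l * ln1p)))"
    using ln1p_nth_0 by (simp add: deg_ln_def fps_binomial_eq_compose)
  ultimately show ?thesis
    using scaled_compose_left_inverse[of expm1 ln1p fps_X ln1p expm1 fps_X "1 / l" l]
      assms ln1p_nth_0
    by (simp add: ln1p_compose_expm1 expm1_compose_ln1p)
qed

section \<open>Expectations of a binomial variable\<close>

text \<open>
  The listed values carry the whole mass, so \<open>g Y\<close> agrees almost everywhere with a finite sum of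
  indicator functions.
\<close>

lemma integral_finite_valued:
  fixes Y :: "'a \<Rightarrow> real" and g :: "real \<Rightarrow> real"
  assumes "prob_space M" and Y: "Y \<in> borel_measurable M" and g: "g \<in> borel_measurable borel"
    and total: "(\<Sum>i\<le>m. \<P>(\<omega> in M. Y \<omega> = real i)) = 1"
  shows "(\<integral>\<omega>. g (Y \<omega>) \<partial>M) = (\<Sum>i\<le>m. \<P>(\<omega> in M. Y \<omega> = real i) * g (real i))"
proof -
  interpret prob_space M by fact
  note [measurable] = Y g
  define A where "A i = {\<omega> \<in> space M. Y \<omega> = real i}" for i :: nat
  have A [measurable]: "A i \<in> sets M" for i
    unfolding A_def by measurable
  have disj: "disjoint_family_on A {..m}"
    by (auto simp: disjoint_family_on_def A_def)
  have "prob (\<Union>i\<le>m. A i) = (\<Sum>i\<le>m. prob (A i))"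
    using A disj by (intro finite_measure_finite_Union) auto
  then have "AE \<omega> in M. \<omega> \<in> (\<Union>i\<le>m. A i)"
    using total by (intro AE_prob_1) (simp add: A_def)
  then have "AE \<omega> in M. g (Y \<omega>) = (\<Sum>i\<le>m. indicator (A i) \<omega> * g (real i))"
  proof eventually_elim
    case (elim \<omega>)
    then obtain i where i: "i \<le> m" "\<omega> \<in> A i" by auto
    then have "indicator (A j) \<omega> * g (real j) = (if j = i then g (real i) else 0)" for j
      by (auto simp: A_def)
    then show ?case using i by (simp add: A_def)
  qed
  then have "(\<integral>\<omega>. g (Y \<omega>) \<partial>M) = (\<integral>\<omega>. (\<Sum>i\<le>m. indicator (A i) \<omega> * g (real i)) \<partial>M)"
    by (intro integral_cong_AE) measurable
  also have "\<dots> = (\<Sum>i\<le>m. \<integral>\<omega>. indicator (A i) \<omega> * g (real i) \<partial>M)"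
    by (intro Bochner_Integration.integral_sum integrable_mult_left) (simp add: emeasure_eq_measure)
  also have "\<dots> = (\<Sum>i\<le>m. prob (A i) * g (real i))"
    using A by (simp add: sets.Int_space_eq2)
  finally show ?thesis by (simp add: A_def)
qed

text \<open>
  Covers \<open>prob_exp\<close> and \<open>prob_deg_exp\<close> at once: \<open>e x\<close> stands for the series of \<open>exp (x t)\<close> or of
  \<open>(1 + l t) powr (x / l)\<close>. At a value \<open>i\<close> of \<open>Y\<close> it is the power \<open>e 1 ^ i\<close>, so its expectation
  \<open>\<Sum>i. (m choose i) * (p * e 1) ^ i * (1 - p) ^ (m - i)\<close> is summed by the binomial theorem.
\<close>

lemma binomial_expectation_series:
  fixes Y :: "'a \<Rightarrow> real" and g :: "nat \<Rightarrow> real \<Rightarrow> real" and e :: "real \<Rightarrow> real fps"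
  assumes "prob_space M" and "Y \<in> borel_measurable M"
    and binomial: "\<And>i. i \<le> m \<Longrightarrow>
      \<P>(\<omega> in M. Y \<omega> = real i) = real (m choose i) * p ^ i * (1 - p) ^ (m - i)"
    and g: "\<And>n. g n \<in> borel_measurable borel"
    and e_nth: "\<And>x n. fps_nth (e x) n = g n x"
    and e_power: "\<And>i. e (real i) = e 1 ^ i"
    and e0: "fps_nth (e 1) 0 = 1"
  shows "Abs_fps (\<lambda>n. if n = 0 then 0 else \<integral>\<omega>. g n (Y \<omega>) \<partial>M) =
    (1 + fps_const p * (e 1 - 1)) ^ m - 1"
proof -
  define P where "P i = \<P>(\<omega> in M. Y \<omega> = real i)" for i :: nat
  have "(\<Sum>i\<le>m. P i) = (p + (1 - p)) ^ m"
    unfolding binomial_ring by (simp add: P_def binomial)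
  then have expectation: "(\<integral>\<omega>. g n (Y \<omega>) \<partial>M) = (\<Sum>i\<le>m. P i * g n (real i))" for n
    unfolding P_def using assms by (intro integral_finite_valued) auto
  have "(1 + fps_const p * (e 1 - 1)) ^ m = (fps_const p * e 1 + fps_const (1 - p)) ^ m"
    by (simp add: algebra_simps flip: fps_const_sub)
  also have "\<dots> = (\<Sum>i\<le>m. fps_const (P i) * e (real i))"
    unfolding binomial_ring e_power
    by (intro sum.cong)
      (simp_all add: P_def binomial power_mult_distrib fps_const_power fps_of_nat[symmetric] mult_ac
        flip: fps_const_mult)
  finally have series: "(1 + fps_const p * (e 1 - 1)) ^ m = (\<Sum>i\<le>m. fps_const (P i) * e (real i))" .
  show ?thesis
  proof (rule fps_ext)
    fix n
    show "fps_nth (Abs_fps (\<lambda>n. if n = 0 then 0 else \<integral>\<omega>. g n (Y \<omega>) \<partial>M)) n =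
      fps_nth ((1 + fps_const p * (e 1 - 1)) ^ m - 1) n"
    proof (cases "n = 0")
      case True
      then show ?thesis by (simp add: fps_nth_power_0 e0)
    next
      case False
      then show ?thesis by (simp add: series expectation fps_sum_nth e_nth)
    qed
  qed
qed

theorem theorem2p2:
  fixes M :: "'a measure" and Y :: "'a \<Rightarrow> real"
    and l p :: real and m n k :: nat
  assumes "l \<noteq> 0" and "m > 0" and "0 < p" and "p \<le> 1"
    and "prob_space M" and "Y \<in> borel_measurable M"
    and "\<And>i. i \<le> m \<Longrightarrow>
           \<P>(\<omega> in M. Y \<omega> = real i) = real (m choose i) * p ^ i * (1 - p) ^ (m - i)"
    and "k \<le> n"
  shows "S2_prob M Y n k =
           (\<Sum>j=k..n. \<Sum>i=j..n. real m ^ j * p ^ i * S2 j k * S1 i j * S2 n i) \<and>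
         S1_prob M Y n k =
           (\<Sum>j=k..n. \<Sum>i=j..n. 1 / p ^ j * (1 / real m ^ i) * S1 j k * S2 i j * S1 n i) \<and>
         S2_prob_deg M Y l n k =
           (\<Sum>j=k..n. \<Sum>i=j..n. real m ^ j * p ^ i * S2 j k * S1 i j * S2_deg l n i) \<and>
         S1_prob_deg M Y l n k =
           (\<Sum>j=k..n. \<Sum>i=j..n. 1 / p ^ j * (1 / real m ^ i) * S1_deg l j k * S2 i j * S1 n i)"
proof -
  let ?series = "\<lambda>h. expm1 oo (fps_const (real m) * (ln1p oo (fps_const p * h)))"
  have prob_exp: "prob_exp M Y = ?series expm1"
  proof -
    have "prob_exp M Y = (1 + fps_const p * (fps_exp 1 - 1)) ^ m - 1"
      using binomial_expectation_series[OF assms(5-7), where g = "\<lambda>n x. x ^ n / fact n" and e = fps_exp]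
      by (simp add: prob_exp_def fps_exp_power_mult cong: if_cong)
    then show ?thesis
      by (simp add: binomial_power_eq_scaled_compose)
  qed
  have prob_deg_exp: "prob_deg_exp M Y l = ?series (deg_exp l 1 - 1)"
  proof -
    have "(\<lambda>x. deg_ffact l x n / fact n) \<in> borel_measurable borel" for n
      unfolding deg_ffact_def by measurable
    then have "prob_deg_exp M Y l = (1 + fps_const p * (deg_exp l 1 - 1)) ^ m - 1"
      using binomial_expectation_series[OF assms(5-7),
          where g = "\<lambda>n x. deg_ffact l x n / fact n" and e = "deg_exp l"]
        deg_exp_of_nat[OF assms(1)] deg_exp_nth_0[of l 1]
      by (simp add: prob_deg_exp_def deg_exp_nth cong: if_cong)
    then show ?thesis
      by (simp add: binomial_power_eq_scaled_compose deg_exp_nth_0)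
  qed
  have inv: "fps_inv (?series h) =
      h' oo (fps_const (1 / p) * (expm1 oo (fps_const (1 / real m) * ln1p)))"
    if "fps_nth h 0 = 0" "h' oo h = fps_X" for h h'
    using that assms(2,3) ln1p_nth_0
    by (intro fps_inv_eqI scaled_compose_left_inverse)
      (simp_all add: ln1p_compose_expm1 expm1_compose_ln1p)
  have "S2_prob M Y n k =
      (\<Sum>j=k..n. \<Sum>i=j..n. real m ^ j * p ^ i * S2 j k * S1 i j * S2 n i)"
    unfolding S2_prob_def S2_def S1_def prob_exp
    by (intro stirling_of_scaled_compose) (simp_all add: ln1p_nth_0)
  moreover have "S2_prob_deg M Y l n k =
      (\<Sum>j=k..n. \<Sum>i=j..n. real m ^ j * p ^ i * S2 j k * S1 i j * S2_deg l n i)"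
    unfolding S2_prob_deg_def S2_deg_def S2_def S1_def prob_deg_exp
    by (intro stirling_of_scaled_compose) (simp_all add: ln1p_nth_0 deg_exp_nth_0)
  moreover have "S1_prob M Y n k =
      (\<Sum>j=k..n. \<Sum>i=j..n. 1 / p ^ j * (1 / real m ^ i) * S1 j k * S2 i j * S1 n i)"
    unfolding S1_prob_def S2_def S1_def prob_exp power_one_over[symmetric]
    by (subst inv[OF _ ln1p_compose_expm1], simp, intro stirling_of_scaled_compose)
      (simp_all add: ln1p_nth_0)
  moreover have "S1_prob_deg M Y l n k =
      (\<Sum>j=k..n. \<Sum>i=j..n. 1 / p ^ j * (1 / real m ^ i) * S1_deg l j k * S2 i j * S1 n i)"
    unfolding S1_prob_deg_def S1_deg_def S2_def S1_def prob_deg_exp power_one_over[symmetric]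
    by (subst inv[OF _ deg_ln_compose_deg_exp[OF assms(1)]], simp add: deg_exp_nth_0,
        intro stirling_of_scaled_compose)
      (simp_all add: ln1p_nth_0 deg_ln_def)
  ultimately show ?thesis by blast
qed

end
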